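(* For every real $t \geq 0$, the closed interval $[0,t]$, with its usual metric $d(x,y) = |x-y|$, has magnitude $$|[0,t]| = 1 + \frac{t}{2}.$$
   Context: For a finite metric space $A$, the similarity matrix $\zeta_A \in \mathbb{R}^{A\times A}$ is $\zeta_A(a,b) = e^{-d(a,b)}$. A weighting on $A$ is a function $w\colon A \to \mathbb{R}$ with $\sum_{b\in A} \zeta_A(a,b) w(b) = 1$ for all $a \in A$. The space $A$ has magnitude if it admits a weighting, and its magnitude is then $|A| = \sum_{a \in A} w(a)$, which is independent of the choice of weighting $w$. A finite metric space $A$ is positive definite if $\zeta_A$ is (strictly) positive definite; then it has magnitude. A metric space is positive definite if each of its finite subspaces is. The magnitude of a compact positive definite metric space $A$ is $|A| = \sup\{|B| : B \text{ a finite subspace of } A\} \in [0,\infty]$ (this agrees with the previous definition when $A$ is finite). Every subspace of $\mathbb{R}$ is positive definite, so $|[0,t]|$ is defined in this sense. *)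

theory Defs
  imports "HOL-Analysis.Analysis"
begin

text \<open>
  A metric space is represented by a subset \<^term>\<open>A\<close> of a type of class \<^class>\<open>metric_space\<close>,
  with the induced metric; its subspaces are then the subsets of \<^term>\<open>A\<close>. Functions on
  \<^term>\<open>A\<close> are total functions whose values outside \<^term>\<open>A\<close> are never inspected.
\<close>

definition similarity :: "'a::metric_space \<Rightarrow> 'a \<Rightarrow> real" where
  "similarity a b = exp (- dist a b)"

definition is_weighting :: "'a::metric_space set \<Rightarrow> ('a \<Rightarrow> real) \<Rightarrow> bool" where
  "is_weighting A w \<longleftrightarrow> (\<forall>a\<in>A. (\<Sum>b\<in>A. similarity a b * w b) = 1)"

text \<open>
  Only meaningful for a finite \<^term>\<open>A\<close> that admits a weighting; the value is then unique by
  \<open>finite_magnitude_eqI\<close> below.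
\<close>

definition finite_magnitude :: "'a::metric_space set \<Rightarrow> real" where
  "finite_magnitude A = (THE m. \<exists>w. is_weighting A w \<and> m = (\<Sum>a\<in>A. w a))"

lemma weighting_sum_unique:
  assumes "is_weighting A v" and "is_weighting A w"
  shows "(\<Sum>a\<in>A. v a) = (\<Sum>a\<in>A. w a)"
proof -
  have "(\<Sum>a\<in>A. v a) = (\<Sum>a\<in>A. v a * (\<Sum>b\<in>A. similarity a b * w b))"
    using assms(2) by (intro sum.cong) (auto simp: is_weighting_def)
  also have "\<dots> = (\<Sum>a\<in>A. \<Sum>b\<in>A. similarity b a * v a * w b)"
    by (simp add: sum_distrib_left similarity_def dist_commute mult_ac)
  also have "\<dots> = (\<Sum>b\<in>A. (\<Sum>a\<in>A. similarity b a * v a) * w b)"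
    by (subst sum.swap) (simp add: sum_distrib_right)
  also have "\<dots> = (\<Sum>b\<in>A. w b)"
    using assms(1) by (intro sum.cong) (auto simp: is_weighting_def)
  finally show ?thesis .
qed

lemma finite_magnitude_eqI:
  assumes "is_weighting A w"
  shows "finite_magnitude A = (\<Sum>a\<in>A. w a)"
  unfolding finite_magnitude_def
  using assms weighting_sum_unique by (intro the_equality) blast+

definition finite_positive_definite :: "'a::metric_space set \<Rightarrow> bool" where
  "finite_positive_definite A \<longleftrightarrow> finite A \<and>
     (\<forall>v. (\<exists>a\<in>A. v a \<noteq> 0) \<longrightarrow> 0 < (\<Sum>a\<in>A. \<Sum>b\<in>A. v a * similarity a b * v b))"

definition positive_definite_space :: "'a::metric_space set \<Rightarrow> bool" where
  "positive_definite_space A \<longleftrightarrow> (\<forall>B. finite B \<and> B \<subseteq> A \<longrightarrow> finite_positive_definite B)"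

text \<open>
  Only meaningful for compact positive definite \<^term>\<open>A\<close>. Since the empty subspace contributes
  \<open>0\<close>, the supremum lies in \<open>[0, \<infinity>]\<close>.
\<close>

definition magnitude :: "'a::metric_space set \<Rightarrow> ereal" where
  "magnitude A = (SUP B\<in>{B. finite B \<and> B \<subseteq> A}. ereal (finite_magnitude B))"

end

theory Submission
  imports Defs "HOL-Real_Asymp.Real_Asymp"
begin

text \<open>
  Everything proceeds by adjoining points on the right. If \<open>c\<close> exceeds the maximum \<open>m\<close> of a finite
  \<open>B\<close>, then \<open>c\<close> sees \<open>B\<close> only through \<open>m\<close>: \<open>\<zeta>(c, b) = q \<zeta>(m, b)\<close> with \<open>q = exp (- (c - m))\<close>.
  Writing \<open>Q\<close> for the quadratic form and \<open>T\<close> for the potential at the maximum, adjoining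
  \<open>c\<close> with coefficient \<open>y\<close> yields \<open>T' = q T + y\<close> and \<open>Q' - T'\<^sup>2 = Q - q\<^sup>2 T\<^sup>2\<close>, so \<open>Q \<ge> T\<^sup>2\<close> persists
  and with it positive definiteness. A weighting extends by moving mass from \<open>m\<close> to \<open>c\<close>, which
  increases the magnitude by \<open>tanh ((c - m) / 2)\<close>. As \<open>tanh x \<le> x\<close>, finite subsets of \<open>[0, t]\<close> have
  magnitude at most \<open>1 + t / 2\<close>, and \<open>n + 1\<close> equally spaced points have magnitude
  \<open>1 + n tanh (t / (2 n))\<close>, which tends to this bound.
\<close>

lemma similarity_self [simp]: "similarity a a = 1"
  by (simp add: similarity_def)

lemma similarity_commute: "similarity a b = similarity b a"
  by (simp add: similarity_def dist_commute)

text \<open>Distances on the line add along an ordered triple, and the exponential turns this into a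
  product.\<close>

lemma similarity_real_mult:
  fixes a b c :: real
  assumes "a \<le> b" "b \<le> c"
  shows "similarity c a = similarity c b * similarity b a"
proof -
  have "- dist c a = - dist c b + - dist b a"
    using assms by (simp add: dist_real_def)
  then show ?thesis by (simp only: similarity_def exp_add)
qed

lemma sum_similarity_insert:
  fixes B :: "real set"
  assumes "finite B" "m \<in> B" "\<And>b. b \<in> B \<Longrightarrow> b \<le> m" "m < c"
  shows "(\<Sum>b\<in>insert c B. similarity c b * v b)
       = v c + similarity c m * (\<Sum>b\<in>B. similarity m b * v b)"
proof -
  have "c \<notin> B" using assms(3)[of c] assms(4) by auto
  moreover have "(\<Sum>b\<in>B. similarity c b * v b) = (\<Sum>b\<in>B. similarity c m * (similarity m b * v b))"
  proof (rule sum.cong[OF refl])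
    fix b assume "b \<in> B"
    then have "similarity c b = similarity c m * similarity m b"
      using assms(3,4) by (intro similarity_real_mult) auto
    then show "similarity c b * v b = similarity c m * (similarity m b * v b)"
      by (simp only: mult.assoc)
  qed
  ultimately show ?thesis
    using assms(1) by (simp add: sum_distrib_left)
qed

lemma sum_similarity_form_insert:
  assumes "finite B" "c \<notin> B"
  shows "(\<Sum>a\<in>insert c B. \<Sum>b\<in>insert c B. v a * similarity a b * v b)
       = (\<Sum>a\<in>B. \<Sum>b\<in>B. v a * similarity a b * v b)
         + 2 * v c * (\<Sum>b\<in>B. similarity c b * v b) + (v c)\<^sup>2"
proof -
  have "(\<Sum>a\<in>B. v a * similarity a c * v c) = v c * (\<Sum>b\<in>B. similarity c b * v b)"
    by (simp add: sum_distrib_left similarity_commute[of _ c] mult_ac)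
  moreover have "(\<Sum>b\<in>B. v c * similarity c b * v b) = v c * (\<Sum>b\<in>B. similarity c b * v b)"
    by (simp add: sum_distrib_left mult_ac)
  ultimately show ?thesis
    using assms by (simp add: sum.distrib power2_eq_square algebra_simps)
qed

text \<open>Positivity alone does not carry through the induction: the cross term created by a new
  maximum is controlled by the square bound, so both are proved together. For empty \<open>B\<close>
  the value of \<open>Max B\<close> is unspecified but never enters the sum.\<close>

lemma similarity_form_real_bounds:
  fixes B :: "real set"
  assumes "finite B"
  shows "(\<Sum>b\<in>B. similarity (Max B) b * v b)\<^sup>2 \<le> (\<Sum>a\<in>B. \<Sum>b\<in>B. v a * similarity a b * v b) \<and>
    ((\<exists>a\<in>B. v a \<noteq> 0) \<longrightarrow> 0 < (\<Sum>a\<in>B. \<Sum>b\<in>B. v a * similarity a b * v b))"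
  using assms
proof (induction B rule: finite_linorder_max_induct)
  case empty
  then show ?case by simp
next
  case (insert c B)
  show ?case
  proof (cases "B = {}")
    case True
    then show ?thesis
      by (auto simp: power2_eq_square) (auto simp: zero_less_mult_iff)
  next
    case False
    define m where "m = Max B"
    define T where "T = (\<Sum>b\<in>B. similarity m b * v b)"
    define Q where "Q = (\<Sum>a\<in>B. \<Sum>b\<in>B. v a * similarity a b * v b)"
    define q where "q = similarity c m"
    define Q' where "Q' = (\<Sum>a\<in>insert c B. \<Sum>b\<in>insert c B. v a * similarity a b * v b)"
    have m: "m \<in> B" "\<And>b. b \<in> B \<Longrightarrow> b \<le> m" "m < c"
      using insert False by (auto simp: m_def)
    have c: "c \<notin> B" "Max (insert c B) = c"
      using insert.hyps by (auto intro!: Max_eqI)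
    have T': "(\<Sum>b\<in>insert c B. similarity c b * v b) = v c + q * T"
      unfolding T_def q_def using sum_similarity_insert insert.hyps(1) m by blast
    then have "(\<Sum>b\<in>B. similarity c b * v b) = q * T"
      using c(1) insert.hyps(1) by simp
    then have Q': "Q' = Q + 2 * v c * (q * T) + (v c)\<^sup>2"
      unfolding Q'_def Q_def using sum_similarity_form_insert[OF insert.hyps(1) c(1)] by simp
    have q: "q\<^sup>2 < 1"
      using m(3) by (simp add: q_def similarity_def dist_real_def power2_eq_square flip: exp_add)
    have QT: "T\<^sup>2 \<le> Q" and Q_pos: "(\<exists>a\<in>B. v a \<noteq> 0) \<Longrightarrow> 0 < Q"
      using insert.IH by (auto simp: T_def Q_def m_def)
    \<comment> \<open>Completing the square in \<open>v c\<close> leaves three nonnegative summands;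
      the first is the new squared potential.\<close>
    have key: "Q' = (v c + q * T)\<^sup>2 + (1 - q\<^sup>2) * T\<^sup>2 + (Q - T\<^sup>2)"
      by (simp add: Q' power2_eq_square algebra_simps)
    have nonneg: "0 \<le> (1 - q\<^sup>2) * T\<^sup>2" using q by simp
    have "0 < Q'" if "\<exists>a\<in>insert c B. v a \<noteq> 0"
    proof (rule ccontr)
      assume "\<not> 0 < Q'"
      then have zero: "(v c + q * T)\<^sup>2 = 0" "(1 - q\<^sup>2) * T\<^sup>2 = 0" "Q - T\<^sup>2 = 0"
        using key nonneg QT zero_le_power2[of "v c + q * T"] by linarith+
      \<comment> \<open>Cancelling \<open>1 - q\<^sup>2\<close> uses that
        \<open>q\<^sup>2 < 1\<close> is strict. All of \<open>v\<close> then vanishes: at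
        \<open>c\<close> by the first square, on \<open>B\<close> because
        \<open>Q = 0\<close>.\<close>
      from zero(2) q have "T = 0" by simp
      with zero have "v c = 0" "Q = 0" by auto
      with Q_pos that show False by auto
    qed
    then show ?thesis
      using key nonneg QT unfolding c(2) T' Q'_def[symmetric] by auto
  qed
qed

lemma positive_definite_space_real: "positive_definite_space (A :: real set)"
  unfolding positive_definite_space_def finite_positive_definite_def
  using similarity_form_real_bounds by blast

lemma tanh_half_real: "tanh (x / 2 :: real) = (1 - exp (- x)) / (1 + exp (- x))"
  by (simp add: tanh_real_altdef)

lemma is_weighting_insert:
  fixes B :: "real set"
  assumes B: "finite B" "m \<in> B" "\<And>b. b \<in> B \<Longrightarrow> b \<le> m" "m < c"
    and w: "is_weighting B w"
  obtains w' where "is_weighting (insert c B) w'"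
    and "sum w' (insert c B) = sum w B + tanh ((c - m) / 2)"
proof
  define q where "q = similarity c m"
  \<comment> \<open>On \<open>B\<close>, mass \<beta> at \<open>c\<close> acts like mass
    \<open>\<beta> * q\<close> at \<open>m\<close>, so removing the latter keeps every potential at
    1. The potential at \<open>c\<close> must satisfy
    \<open>\<beta> + q * (1 - \<beta> * q) = 1\<close>, which forces this value.\<close>
  define \<beta> where "\<beta> = 1 / (1 + q)"
  define w' where "w' = (w(m := w m - \<beta> * q))(c := \<beta>)"
  have "q > 0" by (simp add: q_def similarity_def)
  have c: "c \<notin> B" "m \<noteq> c" using B(3)[of c] B(4) by auto
  \<comment> \<open>Kept general in \<open>f\<close>: rows of the similarity matrix give the
    potentials, the constant 1 gives the total mass.\<close>
  have shift: "(\<Sum>b\<in>B. f b * w' b) = (\<Sum>b\<in>B. f b * w b) - f m * (\<beta> * q)" for f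
  proof -
    have "(\<Sum>b\<in>B. f b * w' b) = (\<Sum>b\<in>B. f b * w b - (if b = m then f m * (\<beta> * q) else 0))"
      using c by (intro sum.cong) (auto simp: w'_def algebra_simps)
    then show ?thesis using B by (simp add: sum_subtractf)
  qed
  have eq1: "(\<Sum>b\<in>B. similarity a b * w b) = 1" if "a \<in> B" for a
    using w that by (simp add: is_weighting_def)
  show "is_weighting (insert c B) w'"
    unfolding is_weighting_def
  proof
    fix a assume "a \<in> insert c B"
    then consider "a = c" | "a \<in> B" by auto
    then show "(\<Sum>b\<in>insert c B. similarity a b * w' b) = 1"
    proof cases
      case 1
      have "(\<Sum>b\<in>insert c B. similarity c b * w' b) = \<beta> + q * (1 - \<beta> * q)"
        using sum_similarity_insert[OF B, of w'] shift[of "similarity m"] eq1[OF B(2)]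
        by (simp add: q_def w'_def)
      also have "\<dots> = 1"
        using \<open>q > 0\<close> by (simp add: \<beta>_def field_simps)
      finally show ?thesis using 1 by simp
    next
      case 2
      have "similarity a c = similarity a m * q"
        using similarity_real_mult[of a m c] B 2
        by (simp add: q_def similarity_commute[of a] mult.commute)
      then show ?thesis
        using B(1) c shift[of "similarity a"] eq1[OF 2] by (simp add: w'_def)
    qed
  qed
  have "sum w' (insert c B) = sum w B + \<beta> * (1 - q)"
    using B(1) c shift[of "\<lambda>_. 1"] by (simp add: w'_def algebra_simps)
  also have "\<beta> * (1 - q) = tanh ((c - m) / 2)"
    using B(4) unfolding tanh_half_real by (simp add: \<beta>_def q_def similarity_def dist_real_def)
  finally show "sum w' (insert c B) = sum w B + tanh ((c - m) / 2)" .
qed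

lemma is_weighting_singleton: "is_weighting {a} (\<lambda>_. 1)"
  by (simp add: is_weighting_def)

lemma tanh_real_le: "tanh x \<le> x" if "x \<ge> 0" for x :: real
proof -
  have "0 - tanh 0 \<le> x - tanh x"
  proof (rule DERIV_nonneg_imp_nondecreasing[OF that])
    fix y :: real
    have "((\<lambda>y. y - tanh y) has_real_derivative (tanh y)\<^sup>2) (at y)"
      by (auto intro!: derivative_eq_intros)
    then show "\<exists>d. ((\<lambda>y. y - tanh y) has_real_derivative d) (at y) \<and> 0 \<le> d"
      by force
  qed
  then show ?thesis by simp
qed

text \<open>Each gap adds at most half its length, and the gaps telescope. A fixed lower bound
  \<open>s\<close> absorbs the distance to the first point, so the singleton case needs only
  \<open>s \<le> c\<close>.\<close>

lemma finite_real_weighting_le: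
  fixes B :: "real set"
  assumes "finite B" "B \<noteq> {}" "\<And>b. b \<in> B \<Longrightarrow> s \<le> b"
  shows "\<exists>w. is_weighting B w \<and> sum w B \<le> 1 + (Max B - s) / 2"
  using assms
proof (induction B rule: finite_linorder_max_induct)
  case empty
  then show ?case by simp
next
  case (insert c B)
  have Max: "Max (insert c B) = c"
    using insert.hyps by (auto intro!: Max_eqI)
  show ?case
  proof (cases "B = {}")
    case True
    then show ?thesis
      using is_weighting_singleton[of c] insert.prems by auto
  next
    case False
    then obtain w where w: "is_weighting B w" "sum w B \<le> 1 + (Max B - s) / 2"
      using insert by auto
    have m: "Max B \<in> B" "\<And>b. b \<in> B \<Longrightarrow> b \<le> Max B" "Max B < c"
      using insert.hyps False by auto
    obtain w' where w': "is_weighting (insert c B) w'"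
        "sum w' (insert c B) = sum w B + tanh ((c - Max B) / 2)"
      using is_weighting_insert[OF insert.hyps(1) m w(1)] by blast
    have "tanh ((c - Max B) / 2) \<le> (c - Max B) / 2"
      using m(3) by (intro tanh_real_le) simp
    with w w' have "sum w' (insert c B) \<le> 1 + (c - s) / 2"
      by argo
    with w'(1) show ?thesis unfolding Max by blast
  qed
qed

lemma finite_magnitude_real_le:
  assumes "finite B" "B \<subseteq> {0..t}" "t \<ge> 0"
  shows "finite_magnitude B \<le> 1 + t / 2"
proof (cases "B = {}")
  case True
  \<comment> \<open>On the empty set every function is a weighting, so the magnitude is the empty
    sum 0.\<close>
  then show ?thesis
    using finite_magnitude_eqI[of B "\<lambda>_. 0"] assms by (simp add: is_weighting_def)
next
  case False
  then obtain w where w: "is_weighting B w" "sum w B \<le> 1 + (Max B - 0) / 2"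
    using finite_real_weighting_le[of B 0] assms by fastforce
  moreover have "Max B \<le> t" using assms False by auto
  ultimately show ?thesis using finite_magnitude_eqI[OF w(1)] by simp
qed

text \<open>Every new point lies exactly \<open>h\<close> beyond the old maximum, so each of the
  \<open>n\<close> extensions adds the same amount.\<close>

lemma equally_spaced_weighting:
  fixes h :: real
  assumes "h > 0"
  shows "\<exists>w. is_weighting ((\<lambda>k. real k * h) ` {..n}) w \<and>
    sum w ((\<lambda>k. real k * h) ` {..n}) = 1 + real n * tanh (h / 2)"
proof (induction n)
  case 0
  then show ?case using is_weighting_singleton[of "0 :: real"] by auto
next
  case (Suc n)
  let ?B = "(\<lambda>k. real k * h) ` {..n}"
  obtain w where w: "is_weighting ?B w" "sum w ?B = 1 + real n * tanh (h / 2)"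
    using Suc by blast
  have B: "finite ?B" "real n * h \<in> ?B" "\<And>b. b \<in> ?B \<Longrightarrow> b \<le> real n * h"
      "real n * h < real (Suc n) * h"
    using assms by auto
  obtain w' where w': "is_weighting (insert (real (Suc n) * h) ?B) w'"
      "sum w' (insert (real (Suc n) * h) ?B)
         = sum w ?B + tanh ((real (Suc n) * h - real n * h) / 2)"
    using is_weighting_insert[OF B w(1)] by blast
  have "real (Suc n) * h - real n * h = h"
    by (simp add: algebra_simps)
  then have "sum w' (insert (real (Suc n) * h) ?B) = 1 + real (Suc n) * tanh (h / 2)"
    using w(2) w'(2) by (simp add: algebra_simps)
  with w'(1) show ?case unfolding atMost_Suc image_insert by blast
qed

lemma finite_magnitude_equally_spaced:
  fixes h :: real
  assumes "h > 0"
  shows "finite_magnitude ((\<lambda>k. real k * h) ` {..n}) = 1 + real n * tanh (h / 2)"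
proof -
  let ?A = "(\<lambda>k. real k * h) ` {..n}"
  obtain w where "is_weighting ?A w" "sum w ?A = 1 + real n * tanh (h / 2)"
    using equally_spaced_weighting[OF assms, of n] by blast
  then show ?thesis
    using finite_magnitude_eqI[of ?A w] by (simp only:)
qed

lemma magnitude_interval_ge:
  fixes t :: real
  assumes "t \<ge> 0"
  shows "ereal (1 + t / 2) \<le> magnitude {0..t}"
proof (cases "t = 0")
  \<comment> \<open>The interval is a single point, and no positive spacing is available.\<close>
  case True
  have "finite_magnitude {0 :: real} = 1"
    using finite_magnitude_eqI[OF is_weighting_singleton[of "0 :: real"]] by simp
  then show ?thesis
    unfolding magnitude_def True by (intro SUP_upper2[of "{0}"]) auto
next
  case False
  with assms have t: "t > 0" by simp
  let ?g = "\<lambda>n. 1 + real n * tanh (t / real n / 2)"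
  have "?g \<longlonglongrightarrow> 1 + t / 2"
    using t by real_asymp
  then have "(\<lambda>n. ereal (?g n)) \<longlonglongrightarrow> ereal (1 + t / 2)"
    by simp
  \<comment> \<open>At \<open>n = 0\<close> the spacing \<open>t / real n\<close> is 0 by
    convention, so the bound is claimed from \<open>n = 1\<close> on, which suffices for the
    limit.\<close>
  moreover have "ereal (?g n) \<le> magnitude {0..t}" if "n \<ge> 1" for n
  proof -
    have "real k * (t / real n) \<le> t" if "k \<le> n" for k
      using that \<open>n \<ge> 1\<close> t by (simp add: field_simps)
    then have "(\<lambda>k. real k * (t / real n)) ` {..n} \<subseteq> {0..t}"
      using t by auto
    then show ?thesis
      unfolding magnitude_def using that t finite_magnitude_equally_spaced[of "t / real n" n]
      by (intro SUP_upper2[of "(\<lambda>k. real k * (t / real n)) ` {..n}"]) auto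
  qed
  ultimately show ?thesis
    using LIMSEQ_le_const2 by blast
qed

theorem theorem3p2p2:
  fixes t :: real
  assumes "t \<ge> 0"
  shows "positive_definite_space {0..t} \<and> magnitude {0..t} = ereal (1 + t / 2)"
proof
  show "positive_definite_space {0..t}"
    by (rule positive_definite_space_real)
  have "magnitude {0..t} \<le> ereal (1 + t / 2)"
    unfolding magnitude_def using assms finite_magnitude_real_le
    by (intro SUP_least) auto
  then show "magnitude {0..t} = ereal (1 + t / 2)"
    using magnitude_interval_ge[OF assms] by (rule antisym)
qed

end
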